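(* The set of all vertices of partition triangles is dense in $\Delta$. In fact, the set of points $\hat X_n$, taken over all $n\ge -1$ and all choices of nonnegative integers $a_0,\dots,a_n$, is dense in $\Delta$.
   Context: Let $\Delta=\{(x,y)\in\mathbb{R}^2: 1\ge x\ge y>0\}$. For each integer $k\ge 0$ let $\Delta_k=\{(x,y)\in\Delta: 1-x-ky\ge 0> 1-x-(k+1)y\}$, and let $T(\alpha,\beta)=\left(\frac{\beta}{\alpha},\frac{1-\alpha-k\beta}{\alpha}\right)$ for $(\alpha,\beta)\in\Delta_k$. A partition triangle is a set $\Delta(a_0,\dots,a_n)=\{(x,y)\in\Delta: T^k(x,y)\in\Delta_{a_k}\text{ for }0\le k\le n\}$ with $n\ge0$ and $a_i$ nonnegative integers; each is a triangle. For nonnegative integers $a_0,a_1,\dots$ define $C_{-3}=(1,0,0)$, $C_{-2}=(0,1,0)$, $C_{-1}=(0,0,1)$, $C_k=C_{k-3}-C_{k-2}-a_kC_{k-1}$ ($k\ge0$), and $X_k=C_k\times C_{k+1}$ (which depends only on $a_0,\dots,a_k$); for $V=(a,b,c)$ with $a\ne0$, $\hat V=(b/a,c/a)\in\mathbb{R}^2$. *)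

theory Defs
  imports "HOL-Analysis.Analysis"
begin

definition Delta :: "(real \<times> real) set" where
  "Delta = {(x, y). 1 \<ge> x \<and> x \<ge> y \<and> y > 0}"

definition Delta_part :: "nat \<Rightarrow> (real \<times> real) set" where
  "Delta_part k = {(x, y) \<in> Delta. 1 - x - real k * y \<ge> 0 \<and> 0 > 1 - x - real (k + 1) * y}"

lemma ex1_Delta_part:
  assumes "p \<in> Delta"
  shows "\<exists>!k. p \<in> Delta_part k"
proof -
  obtain x y where p: "p = (x, y)" by (cases p)
  with assms have xy: "1 \<ge> x" "x \<ge> y" "y > 0" by (auto simp: Delta_def)
  define k where "k = nat \<lfloor>(1 - x) / y\<rfloor>"
  have part_iff: "p \<in> Delta_part j \<longleftrightarrow> \<lfloor>(1 - x) / y\<rfloor> = int j" for j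
    using xy by (auto simp: p Delta_part_def Delta_def floor_eq_iff field_simps)
  have "0 \<le> \<lfloor>(1 - x) / y\<rfloor>" using xy by simp
  then have "p \<in> Delta_part k" unfolding part_iff k_def by simp
  moreover have "j = k" if "p \<in> Delta_part j" for j
    using that unfolding part_iff k_def by simp
  ultimately show ?thesis by blast
qed

(* Only meaningful on Delta, which is mapped into {(x, y). 1 >= x > y >= 0}.  An orbit leaves
   Delta when the second coordinate becomes 0; values of tri_map outside Delta are irrelevant. *)
definition tri_map :: "real \<times> real \<Rightarrow> real \<times> real" where
  "tri_map = (\<lambda>(\<alpha>, \<beta>). let k = (THE k. (\<alpha>, \<beta>) \<in> Delta_part k)
                  in (\<beta> / \<alpha>, (1 - \<alpha> - real k * \<beta>) / \<alpha>))"

lemma tri_map_eq: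
  assumes "(\<alpha>, \<beta>) \<in> Delta_part k"
  shows "tri_map (\<alpha>, \<beta>) = (\<beta> / \<alpha>, (1 - \<alpha> - real k * \<beta>) / \<alpha>)"
proof -
  have "(\<alpha>, \<beta>) \<in> Delta" using assms by (auto simp: Delta_part_def)
  then have "(THE k. (\<alpha>, \<beta>) \<in> Delta_part k) = k"
    using ex1_Delta_part assms by (intro the1_equality) auto
  then show ?thesis by (simp add: tri_map_def)
qed

(* The conditions below k force all earlier iterates to lie in Delta, so the k-th iterate is
   only used where it is genuinely defined.  Only a 0, ..., a n matter. *)
definition partition_triangle :: "(nat \<Rightarrow> nat) \<Rightarrow> nat \<Rightarrow> (real \<times> real) set" where
  "partition_triangle a n = {p \<in> Delta. \<forall>k\<le>n. (tri_map ^^ k) p \<in> Delta_part (a k)}"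

(* Partition triangles contain only part of their boundary, hence the closure.  If the closure
   is convex hull {u, v, w} with u, v, w affinely independent, these are the points u, v, w;
   see extreme_point_of_convex_hull_affine_independent. *)
definition vertices :: "(real \<times> real) set \<Rightarrow> (real \<times> real) set" where
  "vertices P = {v. v extreme_point_of (closure P)}"

(* Indices shifted by 3 so that they start at 0. *)
fun Cshift :: "(nat \<Rightarrow> nat) \<Rightarrow> nat \<Rightarrow> real^3" where
  "Cshift a 0 = vector [1, 0, 0]"
| "Cshift a (Suc 0) = vector [0, 1, 0]"
| "Cshift a (Suc (Suc 0)) = vector [0, 0, 1]"
| "Cshift a (Suc (Suc (Suc k))) =
     Cshift a k - Cshift a (Suc k) - real (a k) *\<^sub>R Cshift a (Suc (Suc k))"

definition Cvec :: "(nat \<Rightarrow> nat) \<Rightarrow> int \<Rightarrow> real^3" where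
  "Cvec a k = Cshift a (nat (k + 3))"

lemma Cvec_initial:
  "Cvec a (-3) = vector [1, 0, 0]" "Cvec a (-2) = vector [0, 1, 0]" "Cvec a (-1) = vector [0, 0, 1]"
  by (simp_all add: Cvec_def numeral_2_eq_2)

lemma Cvec_rec:
  assumes "k \<ge> 0"
  shows "Cvec a k = Cvec a (k - 3) - Cvec a (k - 2) - real (a (nat k)) *\<^sub>R Cvec a (k - 1)"
proof -
  obtain m where k: "k = int m" using assms nonneg_int_cases by blast
  have "nat (k + 3) = Suc (Suc (Suc m))" "nat (k - 3 + 3) = m" "nat (k - 2 + 3) = Suc m"
    "nat (k - 1 + 3) = Suc (Suc m)"
    by (auto simp: k)
  then show ?thesis by (simp add: Cvec_def k)
qed

definition Xvec :: "(nat \<Rightarrow> nat) \<Rightarrow> int \<Rightarrow> real^3" where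
  "Xvec a k = cross3 (Cvec a k) (Cvec a (k + 1))"

definition hat :: "real^3 \<Rightarrow> real \<times> real" where
  "hat V = (V $ 2 / V $ 1, V $ 3 / V $ 1)"

lemma Xvec_initial:
  "Xvec a (-3) = vector [0, 0, 1]" "Xvec a (-2) = vector [1, 0, 0]" "Xvec a (-1) = vector [1, 1, 0]"
proof -
  show "Xvec a (-3) = vector [0, 0, 1]" "Xvec a (-2) = vector [1, 0, 0]"
    by (simp_all add: Xvec_def Cvec_initial cross3_def)
  have "Cvec a 0 = vector [1, -1, - real (a 0)]"
    using Cvec_rec[of 0 a] by (simp add: Cvec_initial vec_eq_iff forall_3)
  then show "Xvec a (-1) = vector [1, 1, 0]"
    by (simp add: Xvec_def Cvec_initial cross3_def)
qed

lemma Xvec_rec: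
  assumes "k \<ge> 0"
  shows "Xvec a k = Xvec a (k - 3) + Xvec a (k - 1) + real (a (nat k)) *\<^sub>R Xvec a (k - 2)"
proof -
  have "Cvec a k = Cvec a (k - 3) - Cvec a (k - 2) - real (a (nat k)) *\<^sub>R Cvec a (k - 1)"
    using Cvec_rec assms by blast
  moreover have "Cvec a (k + 1) = Cvec a (k - 2) - Cvec a (k - 1) - real (a (nat (k + 1))) *\<^sub>R Cvec a k"
    using Cvec_rec[of "k + 1" a] assms by (simp add: algebra_simps)
  moreover have "Xvec a (k - 3) = cross3 (Cvec a (k - 3)) (Cvec a (k - 2))"
    "Xvec a (k - 2) = cross3 (Cvec a (k - 2)) (Cvec a (k - 1))"
    "Xvec a (k - 1) = cross3 (Cvec a (k - 1)) (Cvec a k)"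
    by (simp_all add: Xvec_def)
  ultimately show ?thesis
    unfolding Xvec_def[of a k]
    by (simp add: vec_eq_iff forall_3 cross3_def) (simp add: algebra_simps)
qed

(* hat is only applied to vectors with nonzero first coordinate. *)
lemma Xvec_first_pos: "k \<ge> - 1 \<Longrightarrow> Xvec a k $ 1 > 0"
proof -
  have nonneg: "Xvec a (int m - 3) $ 1 \<ge> 0 \<and> (m \<ge> 1 \<longrightarrow> Xvec a (int m - 3) $ 1 > 0)" for m
  proof (induction m rule: less_induct)
    case (less m)
    consider "m = 0" | "m = 1" | "m = 2" | "m \<ge> 3" by linarith
    then show ?case
    proof cases
      case 4
      have "Xvec a (int m - 3) $ 1 = Xvec a (int (m - 3) - 3) $ 1 + Xvec a (int (m - 1) - 3) $ 1
          + real (a (nat (int m - 3))) * Xvec a (int (m - 2) - 3) $ 1"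
        using Xvec_rec[of "int m - 3" a] 4 by (simp add: of_nat_diff algebra_simps)
      moreover have "Xvec a (int (m - 3) - 3) $ 1 \<ge> 0" "Xvec a (int (m - 1) - 3) $ 1 > 0"
        "Xvec a (int (m - 2) - 3) $ 1 \<ge> 0"
        using less.IH[of "m - 3"] less.IH[of "m - 1"] less.IH[of "m - 2"] 4 by linarith+
      ultimately show ?thesis
        by (smt (verit) mult_nonneg_nonneg of_nat_0_le_iff)
    qed (simp_all add: Xvec_initial)
  qed
  assume "k \<ge> -1"
  then show ?thesis using nonneg[of "nat (k + 3)"] by simp
qed

lemma Xvec_cong:
  assumes "\<And>i. int i \<le> k \<Longrightarrow> a i = b i" and "k \<ge> -3"
  shows "Xvec a k = Xvec b k"
proof -
  have "(\<forall>i. int i \<le> int m - 3 \<longrightarrow> a i = b i) \<longrightarrow> Xvec a (int m - 3) = Xvec b (int m - 3)" for m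
  proof (induction m rule: less_induct)
    case (less m)
    consider "m = 0" | "m = 1" | "m = 2" | "m \<ge> 3" by linarith
    then show ?case
    proof cases
      case 4
      have "Xvec c (int m - 3) = Xvec c (int (m - 3) - 3) + Xvec c (int (m - 1) - 3)
          + real (c (nat (int m - 3))) *\<^sub>R Xvec c (int (m - 2) - 3)" for c
        using Xvec_rec[of "int m - 3" c] 4 by (simp add: of_nat_diff algebra_simps)
      moreover have IH: "Xvec a (int j - 3) = Xvec b (int j - 3)"
        if "j < m" and "\<forall>i. int i \<le> int m - 3 \<longrightarrow> a i = b i" for j
        using less.IH[of j] that by simp
      ultimately show ?thesis
        using IH[of "m - 3"] IH[of "m - 2"] IH[of "m - 1"] 4 by simp
    qed (simp_all add: Xvec_initial)
  qed
  from this[of "nat (k + 3)"] assms show ?thesis by simp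
qed

(* Points of the boundary of Delta that do not belong to Delta are allowed in S.  Intersecting
   S with Delta first gives the same notion. *)
definition dense_in_Delta :: "(real \<times> real) set \<Rightarrow> bool" where
  "dense_in_Delta S \<longleftrightarrow> Delta \<subseteq> closure S"

lemma dense_in_Delta_iff: "dense_in_Delta S \<longleftrightarrow> Delta \<subseteq> closure (S \<inter> Delta)"
proof
  assume S: "dense_in_Delta S"
  have "convex Delta"
  proof -
    have "Delta = {p. inner (1, 0) p \<le> 1} \<inter> {p. inner (-1, 1) p \<le> 0} \<inter> {p. inner (0, 1) p > 0}"
      by (auto simp: Delta_def)
    then show ?thesis
      by (metis convex_Int convex_halfspace_gt convex_halfspace_le)
  qed
  moreover have "interior Delta \<noteq> {}"
  proof -
    let ?U = "{p::real \<times> real. fst p < 1} \<inter> {p. snd p < fst p} \<inter> {p. 0 < snd p}"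
    have "open ?U" by (intro open_Int open_Collect_less continuous_intros)
    moreover have "?U \<subseteq> Delta" by (auto simp: Delta_def)
    moreover have "(1/2, 1/4) \<in> ?U" by simp
    ultimately show ?thesis using interior_maximal by blast
  qed
  ultimately have "Delta \<subseteq> closure (interior Delta)"
    using closure_subset convex_closure_interior by blast
  moreover have "interior Delta \<subseteq> closure (S \<inter> Delta)"
  proof -
    have "interior Delta \<subseteq> interior Delta \<inter> closure S"
      using S interior_subset unfolding dense_in_Delta_def by blast
    also have "\<dots> \<subseteq> closure (interior Delta \<inter> S)"
      by (rule open_Int_closure_subset) simp
    also have "\<dots> \<subseteq> closure (S \<inter> Delta)"
      using interior_subset by (intro closure_mono) blast
    finally show ?thesis .
  qed
  ultimately show "Delta \<subseteq> closure (S \<inter> Delta)"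
    by (metis closure_closure closure_mono subset_trans)
next
  assume "Delta \<subseteq> closure (S \<inter> Delta)"
  then show "dense_in_Delta S"
    unfolding dense_in_Delta_def by (meson closure_mono inf_le1 subset_trans)
qed

end

theory Submission
  imports Defs
begin

text \<open>The partition triangle of \<open>a\<^sub>0, \<dots>, a\<^sub>n\<close> is spanned by \<open>A = X\<^sub>n\<^sub>-\<^sub>1\<close>, \<open>B = X\<^sub>n\<close> and
  \<open>C = X\<^sub>n + X\<^sub>n\<^sub>-\<^sub>2\<close>, and its \<open>q\<close>-th child by \<open>B\<close>, \<open>C + q A\<close>, \<open>C + (q + 1) A\<close>.
  A point \<open>\<alpha> A + \<beta> B + \<gamma> C\<close> with natural coefficients and \<open>\<gamma> > 0\<close> lies in the child
  \<open>q = \<alpha> div \<gamma>\<close>, where its coefficients are \<open>\<beta>\<close>, \<open>\<gamma> - r\<close>, \<open>r\<close> with \<open>r = \<alpha> mod \<gamma>\<close>.  Hence the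
  Euclidean algorithm moves every rational point onto an edge \<open>A B\<close> of some partition triangle.
  There it is the limit of \<open>X\<^sub>n\<^sub>+\<^sub>2 = A + C + N (\<alpha> A + \<beta> B)\<close>, which arises from
  \<open>a\<^sub>n\<^sub>+\<^sub>1 = N \<alpha>\<close> and \<open>a\<^sub>n\<^sub>+\<^sub>2 = N \<beta>\<close>.\<close>

section \<open>Limits of projected vectors\<close>

lemma limit_in_closure:
  fixes f :: "nat \<Rightarrow> 'a::metric_space"
  assumes "\<And>N. f N \<in> S" and "f \<longlonglongrightarrow> l"
  shows "l \<in> closure S"
  unfolding closure_sequential using assms by (intro exI[of _ f]) simp

lemma hat_scaleR: "c \<noteq> 0 \<Longrightarrow> hat (c *\<^sub>R V) = hat V"
  by (simp add: hat_def)

lemma tendsto_hat_perturb: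
  assumes "Z $ 1 \<noteq> 0"
  shows "(\<lambda>N. hat (Z + inverse (real (Suc N)) *\<^sub>R Y)) \<longlonglongrightarrow> hat Z"
proof -
  have "(\<lambda>N. (Z + inverse (real (Suc N)) *\<^sub>R Y) $ i) \<longlonglongrightarrow> Z $ i" for i
    using tendsto_add[OF tendsto_const[of "Z $ i"]
        tendsto_mult[OF LIMSEQ_inverse_real_of_nat tendsto_const[of "Y $ i"]]]
    by simp
  then show ?thesis
    unfolding hat_def using assms by (intro tendsto_Pair tendsto_divide)
qed

text \<open>\<open>hat\<close> ignores scaling, so dividing by \<open>Suc N\<close> turns a growing
  multiple of \<open>Z\<close> into a vanishing perturbation by \<open>Y\<close>.\<close>

lemma hat_in_closure_of_multiples:
  assumes "Z $ 1 \<noteq> 0" and "\<And>N. hat (Y + real (Suc N) *\<^sub>R Z) \<in> S"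
  shows "hat Z \<in> closure S"
proof -
  have "hat (Z + inverse (real (Suc N)) *\<^sub>R Y) \<in> S" for N
  proof -
    have "Y + real (Suc N) *\<^sub>R Z = real (Suc N) *\<^sub>R (Z + inverse (real (Suc N)) *\<^sub>R Y)"
      by (simp add: scaleR_add_right del: of_nat_Suc)
    then show ?thesis
      using assms(2)[of N] hat_scaleR[of "real (Suc N)"] by (simp del: of_nat_Suc)
  qed
  then show ?thesis
    using tendsto_hat_perturb[OF assms(1)] by (rule limit_in_closure)
qed

section \<open>Density of the points obtained from the recursion\<close>

text \<open>With natural indices the entry \<open>a i\<close> first enters at
  \<open>Xshift a (i + 3)\<close>; it can still be chosen freely once the vectors up to
  \<open>i + 2\<close> are fixed.\<close>

definition Xshift :: "(nat \<Rightarrow> nat) \<Rightarrow> nat \<Rightarrow> real^3" where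
  "Xshift a i = Xvec a (int i - 3)"

lemma Xshift_rec:
  "Xshift a (i + 3) = Xshift a i + Xshift a (i + 2) + real (a i) *\<^sub>R Xshift a (i + 1)"
  using Xvec_rec[of "int i" a] by (simp add: Xshift_def algebra_simps)

lemma Xshift_cong:
  assumes "\<And>l. l + 3 \<le> j \<Longrightarrow> a l = b l"
  shows "Xshift a j = Xshift b j"
  unfolding Xshift_def using assms by (intro Xvec_cong) auto

lemma Xshift_first_pos: "i > 0 \<Longrightarrow> Xshift a i $ 1 > 0"
proof (cases "i = 1")
  case True
  then show ?thesis by (simp add: Xshift_def Xvec_initial)
next
  case False
  moreover assume "i > 0"
  ultimately show ?thesis unfolding Xshift_def by (intro Xvec_first_pos) auto
qed

text \<open>Restricting to indices from 0 on gives points that are vertices of partition triangles,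
  so one density result serves both claims.\<close>

definition hat_points :: "(real \<times> real) set" where
  "hat_points = {hat (Xvec a (int k)) | a k. True}"

lemma hat_Xshift_in_hat_points: "hat (Xshift a (k + 3)) \<in> hat_points"
  by (auto simp: hat_points_def Xshift_def)

lemma edge_point_in_closure:
  assumes "\<alpha> + \<beta> > 0"
  shows "hat (real \<alpha> *\<^sub>R Xshift a (i + 1) + real \<beta> *\<^sub>R Xshift a (i + 2)) \<in> closure hat_points"
    (is "hat ?Z \<in> _")
proof (rule hat_in_closure_of_multiples)
  have "Xshift a (i + 1) $ 1 > 0" "Xshift a (i + 2) $ 1 > 0"
    by (simp_all add: Xshift_first_pos)
  with assms show "?Z $ 1 \<noteq> 0"
    by (cases "\<alpha> = 0") (auto intro!: add_pos_nonneg less_imp_neq[THEN not_sym])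
next
  fix N
  \<comment> \<open>The two new entries multiply \<open>Xshift a (i + 1)\<close> and
    \<open>Xshift a (i + 2)\<close> in two successive recursion steps, which builds
    \<open>Suc N\<close> times \<open>?Z\<close>.\<close>
  define b where "b = a(i := Suc N * \<alpha>, i + 1 := Suc N * \<beta>)"
  have old: "Xshift b j = Xshift a j" if "j \<le> i + 2" for j
    using that by (intro Xshift_cong) (auto simp: b_def)
  have "Xshift b (i + 1 + 3) = Xshift b (i + 1) + Xshift b (i + 3)
      + real (Suc N * \<beta>) *\<^sub>R Xshift b (i + 2)"
    using Xshift_rec[of b "i + 1"] by (simp add: b_def eval_nat_numeral)
  moreover have "Xshift b (i + 3) = Xshift b i + Xshift b (i + 2)
      + real (Suc N * \<alpha>) *\<^sub>R Xshift b (i + 1)"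
    using Xshift_rec[of b i] by (simp add: b_def)
  ultimately have "Xshift b (i + 1 + 3) =
      Xshift a i + Xshift a (i + 1) + Xshift a (i + 2) + real (Suc N) *\<^sub>R ?Z"
    by (simp add: old scaleR_add_right algebra_simps)
  then show "hat (Xshift a i + Xshift a (i + 1) + Xshift a (i + 2) + real (Suc N) *\<^sub>R ?Z)
      \<in> hat_points"
    by (metis hat_Xshift_in_hat_points)
qed

lemma natural_combination_in_closure:
  assumes "\<alpha> + \<beta> + \<gamma> > 0"
  shows "hat (real \<alpha> *\<^sub>R Xshift a (i + 1) + real \<beta> *\<^sub>R Xshift a (i + 2)
      + real \<gamma> *\<^sub>R (Xshift a (i + 2) + Xshift a i)) \<in> closure hat_points"
  using assms
proof (induction \<gamma> arbitrary: \<alpha> \<beta> a i rule: less_induct)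
  case (less \<gamma>)
  show ?case
  proof (cases "\<gamma> = 0")
    case True
    then show ?thesis using edge_point_in_closure[of \<alpha> \<beta> a i] less.prems by simp
  next
    case False
    define q r where "q = \<alpha> div \<gamma>" and "r = \<alpha> mod \<gamma>"
    have r: "r < \<gamma>" using False by (simp add: r_def)
    have \<alpha>: "real \<alpha> = real q * real \<gamma> + real r"
      unfolding q_def r_def by (metis div_mult_mod_eq of_nat_add of_nat_mult)
    define b where "b = a(i := q)"
    have old: "Xshift b j = Xshift a j" if "j \<le> i + 2" for j
      using that by (intro Xshift_cong) (auto simp: b_def)
    have "Xshift b (i + 3) = Xshift a i + Xshift a (i + 2) + real q *\<^sub>R Xshift a (i + 1)"
      using Xshift_rec[of b i] old by (simp add: b_def)
    then have "real \<alpha> *\<^sub>R Xshift a (i + 1) + real \<beta> *\<^sub>R Xshift a (i + 2)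
        + real \<gamma> *\<^sub>R (Xshift a (i + 2) + Xshift a i)
      = real \<beta> *\<^sub>R Xshift b (i + 2) + real (\<gamma> - r) *\<^sub>R Xshift b (i + 3)
        + real r *\<^sub>R (Xshift b (i + 3) + Xshift b (i + 1))"
      using r by (simp add: old \<alpha> of_nat_diff algebra_simps)
    moreover have "hat (real \<beta> *\<^sub>R Xshift b (i + 2) + real (\<gamma> - r) *\<^sub>R Xshift b (i + 3)
        + real r *\<^sub>R (Xshift b (i + 3) + Xshift b (i + 1))) \<in> closure hat_points"
      using less.IH[OF r, of \<beta> "\<gamma> - r" b "i + 1"] r by (simp add: eval_nat_numeral)
    ultimately show ?thesis by simp
  qed
qed

text \<open>The initial vectors (1,0,0), (1,1,0), (1,1,1) represent the corners of the closure of
  \<open>Delta\<close>. In terms of them (q, i, j) has the natural coefficients q - i, i - j,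
  j.\<close>

lemma rational_point_in_closure:
  assumes "j \<le> i" and "i \<le> q" and "q > 0"
  shows "(real i / real q, real j / real q) \<in> closure hat_points"
proof -
  fix a
  have X: "Xshift a 0 = vector [0, 0, 1]" "Xshift a 1 = vector [1, 0, 0]"
    "Xshift a 2 = vector [1, 1, 0]"
    by (simp_all add: Xshift_def Xvec_initial)
  let ?P = "real (q - i) *\<^sub>R Xshift a 1 + real (i - j) *\<^sub>R Xshift a 2
      + real j *\<^sub>R (Xshift a 2 + Xshift a 0)"
  have "?P = vector [real q, real i, real j]"
    unfolding X using assms by (simp add: vec_eq_iff forall_3 of_nat_diff)
  then have "hat ?P = (real i / real q, real j / real q)"
    by (simp add: hat_def)
  moreover have "hat ?P \<in> closure hat_points"
    using natural_combination_in_closure[of "q - i" "i - j" j a 0] assms by (simp only: add_0)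
  ultimately show ?thesis by simp
qed

section \<open>Approximation by rational points\<close>

lemma tendsto_floor_mult_divide:
  "(\<lambda>N. of_int \<lfloor>x * real (Suc N)\<rfloor> / real (Suc N)) \<longlonglongrightarrow> (x::real)"
proof (rule tendsto_sandwich)
  have lim: "(\<lambda>N. x - inverse (real (Suc N))) \<longlonglongrightarrow> x - 0"
    by (intro tendsto_diff tendsto_const LIMSEQ_inverse_real_of_nat)
  then show "(\<lambda>N. x - inverse (real (Suc N))) \<longlonglongrightarrow> x" by simp
  show "\<forall>\<^sub>F N in sequentially.
      x - inverse (real (Suc N)) \<le> of_int \<lfloor>x * real (Suc N)\<rfloor> / real (Suc N)"
  proof (rule always_eventually, rule allI)
    fix N
    have "x * real (Suc N) - 1 \<le> of_int \<lfloor>x * real (Suc N)\<rfloor>" by linarith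
    then have "(x * real (Suc N) - 1) / real (Suc N) \<le> of_int \<lfloor>x * real (Suc N)\<rfloor> / real (Suc N)"
      by (rule divide_right_mono) simp
    then show "x - inverse (real (Suc N)) \<le> of_int \<lfloor>x * real (Suc N)\<rfloor> / real (Suc N)"
      by (simp add: diff_divide_distrib inverse_eq_divide del: of_nat_Suc)
  qed
  show "\<forall>\<^sub>F N in sequentially. of_int \<lfloor>x * real (Suc N)\<rfloor> / real (Suc N) \<le> x"
  proof (rule always_eventually, rule allI)
    fix N
    show "of_int \<lfloor>x * real (Suc N)\<rfloor> / real (Suc N) \<le> x"
      by (simp add: divide_le_eq del: of_nat_Suc)
  qed
qed simp

text \<open>Rounding both coordinates down to the same denominator preserves their order and the
  bound 1. The second may become 0, which \<open>rational_point_in_closure\<close> allows.\<close>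

lemma dense_hat_points: "dense_in_Delta hat_points"
  unfolding dense_in_Delta_def
proof
  fix p assume "p \<in> Delta"
  then obtain x y where p: "p = (x, y)" and xy: "x \<le> 1" "y \<le> x" "0 < y"
    by (auto simp: Delta_def)
  let ?f = "\<lambda>t N. of_int \<lfloor>t * real (Suc N)\<rfloor> / real (Suc N) :: real"
  have "(?f x N, ?f y N) \<in> closure hat_points" for N
  proof -
    let ?i = "nat \<lfloor>x * real (Suc N)\<rfloor>" and ?j = "nat \<lfloor>y * real (Suc N)\<rfloor>"
    have "?j \<le> ?i"
      using xy by (intro nat_mono floor_mono mult_right_mono) auto
    moreover have "?i \<le> Suc N"
    proof -
      have "\<lfloor>x * real (Suc N)\<rfloor> \<le> \<lfloor>1 * real (Suc N)\<rfloor>"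
        using xy by (intro floor_mono mult_right_mono) auto
      then show ?thesis by simp
    qed
    ultimately have "(real ?i / real (Suc N), real ?j / real (Suc N)) \<in> closure hat_points"
      by (intro rational_point_in_closure) auto
    moreover have "real ?i = of_int \<lfloor>x * real (Suc N)\<rfloor>" "real ?j = of_int \<lfloor>y * real (Suc N)\<rfloor>"
      using xy by (auto intro!: of_nat_nat)
    ultimately show ?thesis by simp
  qed
  moreover have "(\<lambda>N. (?f x N, ?f y N)) \<longlonglongrightarrow> p"
    unfolding p by (intro tendsto_Pair tendsto_floor_mult_divide)
  ultimately have "p \<in> closure (closure hat_points)"
    by (rule limit_in_closure)
  then show "p \<in> closure hat_points" by simp
qed

section \<open>The points as vertices of partition triangles\<close>

text \<open>These affine forms are homogeneous coordinates for the orbit: the iterates of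
  \<open>tri_map\<close> are ratios of consecutive forms.\<close>

definition lin_form :: "(nat \<Rightarrow> nat) \<Rightarrow> nat \<Rightarrow> real \<times> real \<Rightarrow> real" where
  "lin_form a i p = Cshift a i \<bullet> vector [1, fst p, snd p]"

lemma lin_form_initial:
  "lin_form a 0 p = 1" "lin_form a (Suc 0) p = fst p" "lin_form a (Suc (Suc 0)) p = snd p"
  by (simp_all add: lin_form_def inner_vec_def sum_3)

lemma lin_form_rec:
  "lin_form a (i + 3) p = lin_form a i p - lin_form a (i + 1) p - real (a i) * lin_form a (i + 2) p"
  by (simp add: lin_form_def eval_nat_numeral inner_diff_left)

lemma lin_form_hat:
  assumes "P $ 1 \<noteq> 0"
  shows "lin_form a i (hat P) = (Cshift a i \<bullet> P) / P $ 1"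
  using assms by (simp add: lin_form_def hat_def inner_vec_def sum_3 field_simps)

lemma continuous_on_lin_form: "continuous_on S (lin_form a i)"
  unfolding lin_form_def by (simp add: inner_vec_def sum_3) (intro continuous_intros)

lemma lin_form_convex_combination:
  "lin_form a i ((1 - u) *\<^sub>R p + u *\<^sub>R q) = (1 - u) * lin_form a i p + u * lin_form a i q"
  by (simp add: lin_form_def inner_vec_def sum_3 algebra_simps)

section \<open>Orbits and partition triangles in terms of affine forms\<close>

lemma quotient_in_Delta_part_iff:
  assumes "x > 0"
  shows "(y / x, z / x) \<in> Delta_part k \<longleftrightarrow>
    y \<le> x \<and> z \<le> y \<and> 0 < z \<and> 0 \<le> x - y - real k * z \<and> x - y - real k * z < z"
proof -
  have iff: "(y / x, z / x) \<in> Delta_part k \<longleftrightarrow> y / x \<le> 1 \<and> z / x \<le> y / x \<and> 0 < z / x \<and>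
    0 \<le> 1 - y / x - real k * (z / x) \<and> 1 - y / x - real (k + 1) * (z / x) < 0"
    by (auto simp: Delta_part_def Delta_def)
  have eq: "1 - y / x - real k * (z / x) = (x - y - real k * z) / x"
    "1 - y / x - real (k + 1) * (z / x) = (x - y - real k * z - z) / x"
    using assms by (simp_all add: field_simps)
  show ?thesis
    unfolding iff eq using assms
    by (auto simp: zero_le_divide_iff divide_less_0_iff divide_le_cancel zero_less_divide_iff)
qed

text \<open>On \<open>Delta_part k\<close> the map sends (y/x, z/x) to (z/y, (x - y - k z)/y), and
  the last numerator is the next form. Positivity persists because both coordinates are positive on
  \<open>Delta\<close>.\<close>

lemma tri_map_iterate:
  assumes "\<And>j. j < k \<Longrightarrow> (tri_map ^^ j) p \<in> Delta_part (a j)"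
  shows "lin_form a k p > 0 \<and>
    (tri_map ^^ k) p = (lin_form a (k + 1) p / lin_form a k p, lin_form a (k + 2) p / lin_form a k p)"
  using assms
proof (induction k)
  case 0
  then show ?case by (simp add: lin_form_initial eval_nat_numeral)
next
  case (Suc k)
  let ?x = "lin_form a k p" and ?y = "lin_form a (k + 1) p" and ?z = "lin_form a (k + 2) p"
  have x: "?x > 0" and it: "(tri_map ^^ k) p = (?y / ?x, ?z / ?x)"
    using Suc by simp_all
  have part: "(?y / ?x, ?z / ?x) \<in> Delta_part (a k)"
    using Suc.prems[of k] it by simp
  then have y: "?y > 0" using quotient_in_Delta_part_iff[OF x] by auto
  have "(tri_map ^^ Suc k) p = tri_map (?y / ?x, ?z / ?x)" using it by simp
  also have "\<dots> = (?z / ?y, lin_form a (k + 3) p / ?y)"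
    unfolding tri_map_eq[OF part] lin_form_rec using x y by (simp add: field_simps)
  finally show ?case using y by (simp add: eval_nat_numeral)
qed

text \<open>The inequalities come from the membership condition at time \<open>n\<close>, where
  \<open>lin_form_rec\<close> identifies x - y - \<open>a n\<close> z with the form of index
  \<open>n + 3\<close>.\<close>

lemma partition_triangle_subset:
  "partition_triangle a n \<subseteq> {p. lin_form a (n + 1) p \<ge> lin_form a (n + 2) p} \<inter>
    {p. lin_form a (n + 2) p \<ge> lin_form a (n + 3) p} \<inter> {p. lin_form a (n + 3) p \<ge> 0}"
proof
  fix p assume p: "p \<in> partition_triangle a n"
  let ?x = "lin_form a n p" and ?y = "lin_form a (n + 1) p" and ?z = "lin_form a (n + 2) p"
  have x: "?x > 0" and it: "(tri_map ^^ n) p = (?y / ?x, ?z / ?x)"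
    using tri_map_iterate[of n p a] p by (auto simp: partition_triangle_def)
  have "(?y / ?x, ?z / ?x) \<in> Delta_part (a n)"
    using p it by (auto simp: partition_triangle_def)
  then have "?z \<le> ?y" "0 \<le> ?x - ?y - real (a n) * ?z" "?x - ?y - real (a n) * ?z < ?z"
    using quotient_in_Delta_part_iff[OF x] by auto
  then show "p \<in> {p. lin_form a (n + 1) p \<ge> lin_form a (n + 2) p} \<inter>
    {p. lin_form a (n + 2) p \<ge> lin_form a (n + 3) p} \<inter> {p. lin_form a (n + 3) p \<ge> 0}"
    by (simp add: lin_form_rec)
qed

text \<open>The range up to \<open>n + 1\<close> covers the form of index \<open>n + 3\<close>,
  whose bounds 0 and \<open>lin_form a (n + 2) p\<close> express membership in the part
  \<open>a n\<close>.\<close>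

lemma partition_triangle_if_decreasing:
  assumes "\<And>i. i \<le> n + 1 \<Longrightarrow> lin_form a i p > lin_form a (i + 1) p \<and>
    lin_form a (i + 1) p > lin_form a (i + 2) p \<and> lin_form a (i + 2) p > 0"
  shows "p \<in> partition_triangle a n"
proof -
  have "(tri_map ^^ k) p \<in> Delta_part (a k)" if "k \<le> n" for k
    using that
  proof (induction k rule: less_induct)
    case (less k)
    let ?x = "lin_form a k p" and ?y = "lin_form a (k + 1) p" and ?z = "lin_form a (k + 2) p"
    have x: "?x > 0" and it: "(tri_map ^^ k) p = (?y / ?x, ?z / ?x)"
      using tri_map_iterate[of k p a] less by auto
    have "?x > ?y" "?y > ?z" "?z > 0" "?z > lin_form a (k + 3) p" "lin_form a (k + 3) p > 0"
      using assms[of k] assms[of "k + 1"] less.prems by (simp_all add: eval_nat_numeral)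
    then show ?case
      unfolding it quotient_in_Delta_part_iff[OF x] lin_form_rec by simp
  qed
  moreover have "p \<in> Delta"
    using assms[of 0] by (simp add: lin_form_initial Delta_def split_beta eval_nat_numeral)
  ultimately show ?thesis by (simp add: partition_triangle_def)
qed

section \<open>Duality between the vectors C and X\<close>

lemma Cshift_det: "Cshift a (i + 2) \<bullet> cross3 (Cshift a i) (Cshift a (i + 1)) = 1"
proof (induction i)
  case 0
  then show ?case by (simp add: eval_nat_numeral cross3_def inner_vec_def sum_3)
next
  case (Suc i)
  \<comment> \<open>Only the term \<open>Cshift a i\<close> of the recursion survives in the
    determinant, and a cyclic shift of three rows is even.\<close>
  have "Cshift a (Suc i + 2) \<bullet> cross3 (Cshift a (Suc i)) (Cshift a (Suc i + 1))
      = Cshift a (i + 2) \<bullet> cross3 (Cshift a i) (Cshift a (i + 1))"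
    by (simp add: eval_nat_numeral cross3_def inner_vec_def sum_3 algebra_simps)
  then show ?case using Suc by simp
qed

lemma Xshift_cross3: "Xshift a i = cross3 (Cshift a i) (Cshift a (i + 1))"
  by (simp add: Xshift_def Xvec_def Cvec_def nat_add_distrib)

lemma Cshift_inner_Xshift:
  "Cshift a i \<bullet> Xshift a i = 0" "Cshift a (i + 1) \<bullet> Xshift a i = 0"
  "Cshift a (i + 2) \<bullet> Xshift a i = 1"
  "Cshift a i \<bullet> Xshift a (i + 1) = 1" "Cshift a i \<bullet> Xshift a (i + 2) = 1"
proof -
  show *: "Cshift a i \<bullet> Xshift a i = 0" "Cshift a (i + 1) \<bullet> Xshift a i = 0" for i
    by (simp_all add: Xshift_cross3 dot_cross_self)
  show "Cshift a (i + 2) \<bullet> Xshift a i = 1"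
    using Cshift_det by (simp add: Xshift_cross3)
  show **: "Cshift a i \<bullet> Xshift a (i + 1) = 1" for i
  proof -
    have "Cshift a i \<bullet> cross3 (Cshift a (i + 1)) (Cshift a (i + 2))
        = Cshift a (i + 2) \<bullet> cross3 (Cshift a i) (Cshift a (i + 1))"
      by (simp add: cross3_def inner_vec_def sum_3 algebra_simps)
    then show ?thesis using Cshift_det[of a i] by (simp add: Xshift_cross3 eval_nat_numeral)
  qed
  \<comment> \<open>\<open>Xshift a (i + 2)\<close> is orthogonal to the vectors of index
    \<open>i + 2\<close> and \<open>i + 3\<close>, so only the pairing with
    \<open>Cshift a (i + 1)\<close> remains.\<close>
  have "Cshift a i = Cshift a (i + 3) + Cshift a (i + 1) + real (a i) *\<^sub>R Cshift a (i + 2)"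
    by (simp add: eval_nat_numeral)
  then show "Cshift a i \<bullet> Xshift a (i + 2) = 1"
    using *(1)[of "i + 2"] *(2)[of "i + 2"] **[of "i + 1"]
    by (simp only: inner_add_left inner_scaleR_left) (simp add: eval_nat_numeral del: Cshift.simps)
qed

lemma hat_Xshift_in_closure: "hat (Xshift a (n + 3)) \<in> closure (partition_triangle a n)"
proof -
  \<comment> \<open>This direction points into the triangle: the last three pairings become 1 + e,
    1, e/2, strictly decreasing and positive for 0 < e <= 1.\<close>
  define Y where "Y = Xshift a (n + 2) + (1/2) *\<^sub>R Xshift a (n + 1)"
  define P where "P = (\<lambda>N. Xshift a (n + 3) + inverse (real (Suc N)) *\<^sub>R Y)"
  have "hat (P N) \<in> partition_triangle a n" for N
  proof (rule partition_triangle_if_decreasing)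
    fix i assume i: "i \<le> n + 1"
    define e where "e = inverse (real (Suc N))"
    have e: "0 < e" "e \<le> 1" unfolding e_def by (simp_all add: inverse_le_1_iff)
    have C: "Cshift a (n + 1) \<bullet> P N = 1 + e" "Cshift a (n + 2) \<bullet> P N = 1"
      "Cshift a (n + 3) \<bullet> P N = e / 2"
      using Cshift_inner_Xshift[of a "n + 1"] Cshift_inner_Xshift[of a "n + 2"]
        Cshift_inner_Xshift[of a "n + 3"]
      unfolding P_def Y_def e_def[symmetric]
      by (simp_all add: inner_add_right eval_nat_numeral)
    have pos: "P N $ 1 > 0"
      using Xshift_first_pos[of "n + 1" a] Xshift_first_pos[of "n + 2" a]
        Xshift_first_pos[of "n + 3" a] e
      unfolding P_def Y_def e_def[symmetric] by (simp add: add_pos_pos)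
    \<comment> \<open>Read backwards, the recursion has nonnegative coefficients, so positivity and
      strict decrease pass down from index \<open>n + 1\<close>.\<close>
    have "Cshift a i \<bullet> P N > Cshift a (i + 1) \<bullet> P N \<and> Cshift a (i + 1) \<bullet> P N > Cshift a (i + 2) \<bullet> P N
      \<and> Cshift a (i + 2) \<bullet> P N > 0"
      using i
    proof (induction rule: inc_induct)
      case base
      then show ?case using C e by (simp add: eval_nat_numeral)
    next
      case (step k)
      have "Cshift a k = Cshift a (k + 3) + Cshift a (k + 1) + real (a k) *\<^sub>R Cshift a (k + 2)"
        by (simp add: eval_nat_numeral)
      then have "Cshift a k \<bullet> P N = Cshift a (k + 3) \<bullet> P N + Cshift a (k + 1) \<bullet> P N
          + real (a k) * (Cshift a (k + 2) \<bullet> P N)"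
        by (simp only: inner_add_left inner_scaleR_left)
      moreover have "0 \<le> real (a k) * (Cshift a (k + 2) \<bullet> P N)"
        using step.IH by (intro mult_nonneg_nonneg) (auto simp: eval_nat_numeral)
      moreover have "Cshift a (k + 1) \<bullet> P N > Cshift a (k + 2) \<bullet> P N"
        "Cshift a (k + 2) \<bullet> P N > Cshift a (k + 3) \<bullet> P N" "Cshift a (k + 3) \<bullet> P N > 0"
        using step.IH by (simp_all add: eval_nat_numeral del: Cshift.simps)
      ultimately show ?case by linarith
    qed
    then show "lin_form a i (hat (P N)) > lin_form a (i + 1) (hat (P N)) \<and>
      lin_form a (i + 1) (hat (P N)) > lin_form a (i + 2) (hat (P N)) \<and>
      lin_form a (i + 2) (hat (P N)) > 0"
      using pos by (simp add: lin_form_hat divide_strict_right_mono)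
  qed
  moreover have "(\<lambda>N. hat (P N)) \<longlonglongrightarrow> hat (Xshift a (n + 3))"
    unfolding P_def using Xshift_first_pos[of "n + 3" a] by (intro tendsto_hat_perturb) simp
  ultimately show ?thesis
    by (rule limit_in_closure)
qed

text \<open>By the recursion the form of index \<open>n + 4\<close> vanishes too. Hence (1, p) is
  orthogonal to two consecutive C and so parallel to their cross product.\<close>

lemma eq_hat_Xshift:
  assumes "lin_form a (n + 3) p = 0" and "lin_form a (n + 1) p = lin_form a (n + 2) p"
  shows "p = hat (Xshift a (n + 3))"
proof -
  let ?v = "vector [1, fst p, snd p] :: real^3" and ?X = "Xshift a (n + 3)"
  have "?v \<bullet> Cshift a (n + 3) = 0" using assms by (simp add: lin_form_def inner_commute)
  moreover have "?v \<bullet> Cshift a (n + 4) = 0"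
    using lin_form_rec[of a "n + 1" p] assms
    by (simp add: lin_form_def inner_commute eval_nat_numeral)
  ultimately have "cross3 ?v ?X = 0"
    by (simp add: Xshift_cross3 Lagrange eval_nat_numeral)
  then have "fst p * ?X $ 1 = ?X $ 2" "snd p * ?X $ 1 = ?X $ 3"
    by (simp_all add: cross3_def vec_eq_iff forall_3)
  then show ?thesis
    using Xshift_first_pos[of "n + 3" a] by (simp add: hat_def prod_eq_iff field_simps)
qed

lemma hat_Xvec_vertex: "hat (Xvec a (int n)) \<in> vertices (partition_triangle a n)"
proof -
  let ?X = "hat (Xshift a (n + 3))" and ?L = "\<lambda>i. lin_form a i"
  let ?K = "{p. ?L (n + 1) p \<ge> ?L (n + 2) p} \<inter> {p. ?L (n + 2) p \<ge> ?L (n + 3) p} \<inter>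
    {p. ?L (n + 3) p \<ge> 0}"
  have "closed ?K"
    by (intro closed_Int closed_Collect_le continuous_on_lin_form continuous_on_const)
  then have K: "closure (partition_triangle a n) \<subseteq> ?K"
    using partition_triangle_subset by (intro closure_minimal)
  \<comment> \<open>The vertex is the only common zero of two forms that are nonnegative on the triangle,
    hence it is exposed.\<close>
  have X: "?L (n + 3) ?X = 0" "?L (n + 1) ?X = ?L (n + 2) ?X"
    using Cshift_inner_Xshift(1)[of a "n + 3"] Cshift_inner_Xshift(4)[of a "n + 2"]
      Cshift_inner_Xshift(5)[of a "n + 1"] Xshift_first_pos[of "n + 3" a]
    by (simp_all add: lin_form_hat eval_nat_numeral)
  have "?X \<notin> open_segment p q"
    if "p \<in> closure (partition_triangle a n)" "q \<in> closure (partition_triangle a n)" for p q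
  proof
    have pq: "p \<in> ?K" "q \<in> ?K" using that K by blast+
    assume "?X \<in> open_segment p q"
    then obtain u where u: "0 < u" "u < 1" "?X = (1 - u) *\<^sub>R p + u *\<^sub>R q" and neq: "p \<noteq> q"
      by (auto simp: in_segment)
    have zero: "s = 0 \<and> t = 0" if "(1 - u) * s + u * t = 0" "s \<ge> 0" "t \<ge> 0" for s t :: real
      using that u by (simp add: add_nonneg_eq_0_iff)
    have "?L (n + 3) p = 0 \<and> ?L (n + 3) q = 0"
      using X(1) pq by (intro zero) (auto simp: u(3) lin_form_convex_combination)
    moreover have "?L (n + 1) p - ?L (n + 2) p = 0 \<and> ?L (n + 1) q - ?L (n + 2) q = 0"
    proof (rule zero)
      show "(1 - u) * (?L (n + 1) p - ?L (n + 2) p) + u * (?L (n + 1) q - ?L (n + 2) q) = 0"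
        using X(2) unfolding u(3) lin_form_convex_combination right_diff_distrib by linarith
    qed (use pq in auto)
    ultimately have "p = ?X" "q = ?X"
      using eq_hat_Xshift by auto
    then show False using neq by simp
  qed
  then have "?X \<in> vertices (partition_triangle a n)"
    unfolding vertices_def extreme_point_of_def mem_Collect_eq
    by (intro conjI ballI hat_Xshift_in_closure)
  then show ?thesis by (simp add: Xshift_def)
qed

theorem theorem19:
  shows "dense_in_Delta (\<Union>a n. vertices (partition_triangle a n)) \<and>
         dense_in_Delta {hat (Xvec a n) | a n. n \<ge> -1}"
proof -
  have mono: "dense_in_Delta S" if "hat_points \<subseteq> S" for S
    using that dense_hat_points closure_mono unfolding dense_in_Delta_def by blast
  have "hat_points \<subseteq> (\<Union>a n. vertices (partition_triangle a n))"
    unfolding hat_points_def using hat_Xvec_vertex by blast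
  moreover have "hat_points \<subseteq> {hat (Xvec a n) | a n. n \<ge> -1}"
  proof
    fix v assume "v \<in> hat_points"
    then obtain a k where "v = hat (Xvec a (int k))" by (auto simp: hat_points_def)
    moreover have "int k \<ge> -1" by simp
    ultimately show "v \<in> {hat (Xvec a n) | a n. n \<ge> -1}" by blast
  qed
  ultimately show ?thesis using mono by blast
qed

end
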